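(* Let $q\geq 2$ be an integer and let $\mathcal{L}$ denote the equation $qx+qy=z$. Then, as $n\to\infty$, $f_{\max}(n,\mathcal{L})=2^{n/(2q)+o(n)}$.
   Context: $[n]=\{1,\dots,n\}$. A set $A\subseteq[n]$ is $\mathcal{L}$-free if there are no $x,y,z\in A$ (not necessarily distinct) with $qx+qy=z$. $f_{\max}(n,\mathcal{L})$ denotes the number of maximal (with respect to inclusion) $\mathcal{L}$-free subsets of $[n]$. *)

theory Defs
  imports Complex_Main "HOL-Library.Landau_Symbols"
begin

definition L_free :: "nat \<Rightarrow> nat set \<Rightarrow> bool" where
  "L_free q A \<longleftrightarrow> \<not> (\<exists>x\<in>A. \<exists>y\<in>A. \<exists>z\<in>A. q * x + q * y = z)"

definition maximal_L_free :: "nat \<Rightarrow> nat \<Rightarrow> nat set \<Rightarrow> bool" where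
  "maximal_L_free q n A \<longleftrightarrow>
     A \<subseteq> {1..n} \<and> L_free q A \<and> (\<forall>B. B \<subseteq> {1..n} \<and> L_free q B \<and> A \<subseteq> B \<longrightarrow> B = A)"

definition f_max :: "nat \<Rightarrow> nat \<Rightarrow> nat" where
  "f_max n q = card {A. maximal_L_free q n A}"

end

theory Submission
  imports Defs "HOL-Real_Asymp.Real_Asymp"
begin

text \<open>
  Let \<open>N = n div q\<close>. A maximal \<open>M\<close> is determined by \<open>A = M \<inter> [N]\<close>, because an element above \<open>N\<close> can
  only occur as \<open>z\<close>. Put \<open>E = {s \<le> N. q s \<in> M}\<close>, so that no two elements of \<open>A\<close> sum to an element
  of \<open>E\<close>. Let \<open>F\<close> consist of the \<open>h\<close> largest elements of \<open>E\<close> (if \<open>E\<close> has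
  at most \<open>h\<close> elements, take \<open>F = E\<close> and \<open>e = 0\<close> below). A greedily chosen fingerprint
  \<open>T \<subseteq> A\<close> with \<open>|T| \<le> N / k\<close> confines \<open>A\<close> to a container \<open>P\<close>, depending on \<open>F\<close> and \<open>T\<close> only, in which
  the graph \<open>x + y \<in> F\<close> has degrees below \<open>k\<close>. So some \<open>e \<in> F\<close> has at most \<open>k N / h\<close> representations
  as a sum from \<open>P\<close>, and the reflection \<open>x \<mapsto> e - x\<close> shows that \<open>P\<close> has at most about \<open>e / 2\<close> elements
  below \<open>e\<close>. For \<open>x > w = max e (N / 2)\<close>, membership in \<open>M\<close> depends only on \<open>M \<inter> [w]\<close> and on the part
  of \<open>E\<close> above \<open>e\<close>, which lies in \<open>F\<close>. As \<open>|P \<inter> [w]| \<le> N / 2 + o(N)\<close>, there are at most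
  \<open>2 ^ (N / 2 + o(N))\<close> maximal sets once \<open>F\<close>, \<open>T\<close>, \<open>e\<close> are fixed, and \<open>h = n powr (3/4)\<close>,
  \<open>k = n powr (1/4)\<close> leave only \<open>2 ^ o(n)\<close> choices for these.

  For the lower bound, decide for each \<open>x\<close> with \<open>N / 2 < x < N\<close> whether to take \<open>x\<close> or \<open>q (x + 1)\<close>.
  Together with \<open>1\<close> the result is solution-free, and any two choices have distinct maximal
  extensions.
\<close>

section \<open>Small subsets and upper parts of finite sets\<close>

text \<open>Padding with 0, which lies outside \<open>{1..N}\<close>, encodes each such set as a
  list of length exactly \<open>h\<close> over \<open>N + 1\<close> symbols.\<close>

lemma card_small_subsets_le:
  "card {F. F \<subseteq> {1..N} \<and> card F \<le> h} \<le> (N + 1) ^ h" for N h :: nat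
proof -
  let ?L = "{xs. set xs \<subseteq> {0..N} \<and> length xs = h}"
  have "F \<in> (\<lambda>xs. set xs - {0}) ` ?L" if F: "F \<subseteq> {1..N}" "card F \<le> h" for F
  proof
    have fin: "finite F" using F(1) finite_subset by blast
    define xs where "xs = sorted_list_of_set F @ replicate (h - card F) 0"
    show "F = set xs - {0}" unfolding xs_def using fin F(1) by (auto simp: set_replicate_conv_if)
    show "xs \<in> ?L" unfolding xs_def using fin F by (auto simp: set_replicate_conv_if)
  qed
  hence "{F. F \<subseteq> {1..N} \<and> card F \<le> h} \<subseteq> (\<lambda>xs. set xs - {0}) ` ?L" by blast
  moreover have "finite ?L" by (rule finite_lists_length_eq) simp
  ultimately have "card {F. F \<subseteq> {1..N} \<and> card F \<le> h} \<le> card ?L"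
    by (rule surj_card_le[rotated])
  also have "card ?L = (N + 1) ^ h" by (simp add: card_lists_length_eq)
  finally show ?thesis .
qed

lemma exists_upper_part:
  fixes E :: "'a :: linorder set"
  assumes "finite E"
  shows "\<exists>F\<subseteq>E. (\<forall>e\<in>F. \<forall>e'\<in>E. e < e' \<longrightarrow> e' \<in> F) \<and> card F \<le> h \<and> (F = E \<or> card F = h)"
proof (induction h)
  case 0
  show ?case by (rule exI[of _ "{}"]) auto
next
  case (Suc h)
  then obtain F where F: "F \<subseteq> E" "\<forall>e\<in>F. \<forall>e'\<in>E. e < e' \<longrightarrow> e' \<in> F" "card F \<le> h"
    "F = E \<or> card F = h" by blast
  show ?case
  proof (cases "F = E")
    case True
    with F show ?thesis by (intro exI[of _ F]) auto
  next
    case False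
    hence ne: "E - F \<noteq> {}" "finite (E - F)" "finite F" 
      using F(1) assms finite_subset by auto
    \<comment> \<open>Adding the largest element still missing keeps \<open>F\<close> upward closed
      in \<open>E\<close>.\<close>
    define m where "m = Max (E - F)"
    have m: "m \<in> E - F" using Max_in[OF ne(2,1)] by (simp add: m_def)
    have "e' \<in> insert m F" if "m < e'" "e' \<in> E" for e'
      using Max_ge[OF ne(2), of e'] that by (auto simp: m_def)
    with F m ne False show ?thesis
      by (intro exI[of _ "insert m F"]) auto
  qed
qed

subsection \<open>Containers for the Cayley sum graph\<close>

text \<open>In the graph on \<open>{1..N}\<close> joining \<open>x\<close> and \<open>y\<close> when
  \<open>x + y \<in> F\<close>, these are the non-neighbours of \<open>T\<close> that have fewer
  than \<open>k\<close> neighbours among the non-neighbours of \<open>T\<close>.\<close>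

definition sum_container :: "nat \<Rightarrow> nat \<Rightarrow> nat set \<Rightarrow> nat set \<Rightarrow> nat set" where
  "sum_container N k F T = {y\<in>{1..N}. (\<forall>t\<in>T. t + y \<notin> F) \<and>
     card {z\<in>{1..N}. (\<forall>t\<in>T. t + z \<notin> F) \<and> y + z \<in> F} < k}"

lemma sum_container_subset: "sum_container N k F T \<subseteq> {1..N}"
  by (auto simp: sum_container_def)

text \<open>Take \<open>T\<close> maximal among the subsets of \<open>A\<close> with at least
  \<open>k\<close> neighbours per element on average. A vertex of \<open>A\<close> outside the
  container would bring \<open>k\<close> new neighbours and could join \<open>T\<close>.\<close>

lemma sum_container_covers:
  assumes A: "A \<subseteq> {1..N}" and indep: "\<And>x y. x \<in> A \<Longrightarrow> y \<in> A \<Longrightarrow> x + y \<notin> F"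
    and k: "k > 0"
  shows "\<exists>T\<subseteq>A. card T * k \<le> N \<and> A \<subseteq> sum_container N k F T"
proof -
  define nb where "nb T = {z\<in>{1..N}. \<exists>t\<in>T. t + z \<in> F}" for T
  define S where "S = {T. T \<subseteq> A \<and> card T * k \<le> card (nb T)}"
  have finA: "finite A" using A finite_subset by blast
  have finS: "finite S" unfolding S_def using finA by simp
  have "{} \<in> S" by (simp add: S_def)
  hence "S \<noteq> {}" by blast
  then obtain T where T: "T \<in> S" and Tmax: "\<And>T'. T' \<in> S \<Longrightarrow> T \<subseteq> T' \<Longrightarrow> T = T'"
    using finite_has_maximal[OF finS] by blast
  have TA: "T \<subseteq> A" and Tk: "card T * k \<le> card (nb T)" using T by (auto simp: S_def)
  have finT: "finite T" using TA finA finite_subset by blast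
  have fin_nb: "finite (nb U)" for U by (simp add: nb_def)
  have "card (nb T) \<le> card {1..N}" by (rule card_mono) (auto simp: nb_def)
  hence small: "card T * k \<le> N" using Tk by simp
  have "a \<in> sum_container N k F T" if a: "a \<in> A" for a
  proof (rule ccontr)
    let ?D = "{z\<in>{1..N}. (\<forall>t\<in>T. t + z \<notin> F) \<and> a + z \<in> F}"
    assume "a \<notin> sum_container N k F T"
    \<comment> \<open>Independence of \<open>A\<close> makes \<open>a\<close> a non-neighbour of
      \<open>T\<close>, so only the degree condition can fail.\<close>
    hence D: "k \<le> card ?D" using a A TA indep by (auto simp: sum_container_def)
    have "a \<notin> T"
    proof
      assume "a \<in> T"
      hence "?D = {}" by blast
      hence "card ?D = 0" by (simp only: card.empty)
      with D k show False by linarith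
    qed
    have "card (nb T) + card ?D = card (nb T \<union> ?D)"
      by (rule card_Un_disjoint[symmetric]) (auto simp: nb_def)
    also have "\<dots> \<le> card (nb (insert a T))" by (rule card_mono) (auto simp: nb_def)
    finally have "insert a T \<in> S" using D Tk TA a finT \<open>a \<notin> T\<close> by (auto simp: S_def)
    hence "T = insert a T" using Tmax by blast
    with \<open>a \<notin> T\<close> show False by blast
  qed
  with TA small show ?thesis by blast
qed


text \<open>Double counting of the pairs \<open>(x, e)\<close>: every \<open>x\<close> in
  \<open>P\<close> has degree below \<open>k\<close>, and the \<open>e\<close> with the fewest
  representations has at most the average number.\<close>

lemma sum_container_few_sums:
  assumes F: "finite F" "F \<noteq> {}" and P: "P = sum_container N k F T"
  shows "\<exists>e\<in>F. card F * card {x\<in>P. x < e \<and> e - x \<in> P} \<le> k * N"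
proof -
  define r where "r e = card {x\<in>P. x < e \<and> e - x \<in> P}" for e
  have finP: "finite P" and PN: "card P \<le> N"
    using sum_container_subset[of N k F T] card_mono[of "{1..N}" P] finite_subset[of P "{1..N}"]
    by (auto simp: P)
  have deg: "card {e\<in>F. x < e \<and> e - x \<in> P} \<le> k" if x: "x \<in> P" for x
  proof -
    let ?D = "{z\<in>{1..N}. (\<forall>t\<in>T. t + z \<notin> F) \<and> x + z \<in> F}"
    have "{e\<in>F. x < e \<and> e - x \<in> P} \<subseteq> (\<lambda>z. x + z) ` ?D"
    proof
      fix e assume e: "e \<in> {e\<in>F. x < e \<and> e - x \<in> P}"
      hence "e - x \<in> ?D" using P by (auto simp: sum_container_def)
      moreover have "e = x + (e - x)" using e by simp
      ultimately show "e \<in> (\<lambda>z. x + z) ` ?D" by blast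
    qed
    hence "card {e\<in>F. x < e \<and> e - x \<in> P} \<le> card ?D"
      by (rule surj_card_le[rotated]) simp
    also have "\<dots> \<le> k" using x P by (simp add: sum_container_def)
    finally show ?thesis .
  qed
  obtain e where e: "e \<in> F" "\<And>e'. e' \<in> F \<Longrightarrow> r e \<le> r e'"
    using ex_min_if_finite[of "r ` F"] F by (metis (mono_tags, lifting) finite_imageI image_iff
        image_is_empty linorder_not_less)
  have "card F * r e \<le> (\<Sum>e\<in>F. r e)"
    using sum_bounded_below[of F "r e" r] e(2) by simp
  also have "\<dots> = (\<Sum>e\<in>F. \<Sum>x\<in>P. if x < e \<and> e - x \<in> P then 1 else 0)"
    unfolding r_def using finP by (simp add: sum.If_cases Int_def)
  also have "\<dots> = (\<Sum>x\<in>P. \<Sum>e\<in>F. if x < e \<and> e - x \<in> P then 1 else 0)"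
    by (rule sum.swap)
  also have "\<dots> = (\<Sum>x\<in>P. card {e\<in>F. x < e \<and> e - x \<in> P})"
    using F(1) by (simp add: sum.If_cases Int_def)
  also have "\<dots> \<le> card P * k" using sum_bounded_above[of P _ k] deg by simp
  also have "\<dots> \<le> k * N" using PN by (simp add: mult.commute)
  finally show ?thesis using e(1) unfolding r_def by blast
qed

text \<open>The part of \<open>P\<close> below \<open>e\<close> and its reflection both lie in
  \<open>{1..<e}\<close>, and they overlap only in representations of \<open>e\<close>. The points
  from \<open>e\<close> to the maximum are counted trivially.\<close>

lemma card_reflection_le:
  fixes P :: "nat set"
  assumes P: "P \<subseteq> {1..N}" and e: "1 \<le> e" "e \<le> N"
  shows "2 * card (P \<inter> {1..max e (N div 2)}) \<le> N + 1 + card {x\<in>P. x < e \<and> e - x \<in> P}"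
proof -
  let ?Q = "P \<inter> {1..<e}" and ?w = "max e (N div 2)"
  have fin: "finite ?Q" by simp
  have inj: "inj_on (\<lambda>x. e - x) ?Q" by (auto simp: inj_on_def)
  have "card ?Q + card ((\<lambda>x. e - x) ` ?Q) = card (?Q \<union> (\<lambda>x. e - x) ` ?Q) + card (?Q \<inter> (\<lambda>x. e - x) ` ?Q)"
    by (rule card_Un_Int) auto
  moreover have "card (?Q \<union> (\<lambda>x. e - x) ` ?Q) \<le> card {1..<e}"
    by (rule card_mono) auto
  moreover have "card (?Q \<inter> (\<lambda>x. e - x) ` ?Q) \<le> card {x\<in>P. x < e \<and> e - x \<in> P}"
    by (rule card_mono) (use finite_subset[OF P] in auto)
  ultimately have Q: "2 * card ?Q \<le> (e - 1) + card {x\<in>P. x < e \<and> e - x \<in> P}"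
    using card_image[OF inj] by (simp only: card_atLeastLessThan)
  have "card (P \<inter> {1..?w}) \<le> card (?Q \<union> {e..?w})" by (rule card_mono) auto
  also have "\<dots> \<le> card ?Q + card {e..?w}" by (rule card_Un_le)
  finally have "card (P \<inter> {1..?w}) \<le> card ?Q + (Suc ?w - e)" by simp
  \<comment> \<open>With \<open>w\<close> the maximum, the sum is at most
    \<open>2 * w - e + 1\<close> plus the representations: \<open>e + 1\<close> if
    \<open>w = e\<close>, and at most \<open>N\<close> if \<open>w = N div 2\<close>.\<close>
  with Q e show ?thesis by (auto simp: max_def split: if_splits)
qed

subsection \<open>Maximal solution-free sets\<close>

lemma maximal_L_free_conflict:
  assumes "maximal_L_free q n M" "q \<ge> 2" "x \<in> {1..n}" "x \<notin> M"
  shows "(\<exists>y\<in>M. \<exists>z\<in>M. x = q * y + q * z) \<or> (\<exists>y\<in>insert x M. \<exists>z\<in>M. q * x + q * y = z)"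
proof -
  have "insert x M \<subseteq> {1..n}" "insert x M \<noteq> M" "M \<subseteq> insert x M"
    using assms by (auto simp: maximal_L_free_def)
  hence "\<not> L_free q (insert x M)" using assms(1) unfolding maximal_L_free_def by metis
  then obtain a b c where abc: "a \<in> insert x M" "b \<in> insert x M" "c \<in> insert x M" "q * a + q * b = c"
    unfolding L_free_def by blast
  have M: "L_free q M" using assms(1) by (simp add: maximal_L_free_def)
  \<comment> \<open>Hence \<open>x\<close> cannot be both the right-hand side and a summand of the
    new solution.\<close>
  have big: "q * x > x" using assms by auto
  show ?thesis
  proof (cases "c = x")
    case True
    with abc(4) have "q * a \<le> x" "q * b \<le> x" by simp_all
    with big have "a \<noteq> x" "b \<noteq> x" by auto
    with abc have "a \<in> M" "b \<in> M" by blast+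
    with True abc show ?thesis by blast
  next
    case False
    with abc(3) have c: "c \<in> M" by blast
    with abc M have "a = x \<or> b = x" unfolding L_free_def by blast
    with abc c show ?thesis by (metis add.commute)
  qed
qed

lemma exists_maximal_L_free:
  assumes "B \<subseteq> {1..n}" "L_free q B"
  shows "\<exists>M. maximal_L_free q n M \<and> B \<subseteq> M"
proof -
  let ?S = "{A. A \<subseteq> {1..n} \<and> L_free q A}"
  have "finite ?S" by simp
  moreover have "B \<in> ?S" using assms by simp
  ultimately obtain M where "M \<in> ?S" "B \<subseteq> M" "\<forall>A\<in>?S. M \<subseteq> A \<longrightarrow> M = A"
    using finite_has_maximal2[of ?S B] by blast
  thus ?thesis unfolding maximal_L_free_def by blast
qed

lemma finite_maximal_L_free: "finite {M. maximal_L_free q n M}"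
  by (rule finite_subset[of _ "Pow {1..n}"]) (auto simp: maximal_L_free_def)

text \<open>If \<open>x\<close> were missing from \<open>M2\<close>, some conflict in
  \<open>M2\<close> would exclude it. All elements of that conflict other than \<open>x\<close> lie
  where \<open>M1\<close> and \<open>M2\<close> agree, so \<open>M1\<close> would contain a
  solution.\<close>

lemma maximal_L_free_subsetI:
  assumes q: "q \<ge> 2" and M1: "maximal_L_free q n M1" and M2: "maximal_L_free q n M2"
    and w: "e \<le> w" "n div q div 2 \<le> w"
    and low: "M1 \<inter> {1..w} = M2 \<inter> {1..w}"
    and high: "\<And>s. s \<in> {e<..n div q} \<Longrightarrow> q * s \<in> M1 \<longleftrightarrow> q * s \<in> M2"
    and x: "x \<in> M1" "x \<le> n div q"
  shows "x \<in> M2"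
proof (rule ccontr)
  assume nx: "x \<notin> M2"
  let ?N = "n div q"
  have sub: "M1 \<subseteq> {1..n}" "M2 \<subseteq> {1..n}" and free: "L_free q M1"
    using M1 M2 by (auto simp: maximal_L_free_def)
  have xn: "x \<in> {1..n}" using x sub by blast
  have "x \<notin> {1..w}" using low x nx by blast
  hence xw: "x > w" using xn by simp
  have half: "y \<in> M1" if "y \<in> M2" "y \<le> w" for y
  proof -
    have "y \<in> {1..w}" using that sub by auto
    with low that show ?thesis by blast
  qed
  from maximal_L_free_conflict[OF M2 q xn nx] show False
  proof (elim disjE bexE)
    fix y z assume yz: "y \<in> M2" "z \<in> M2" "x = q * y + q * z"
    have "2 * (y + z) \<le> q * (y + z)" using q by (rule mult_right_mono) simp
    hence "2 * (y + z) \<le> ?N" using yz x by (simp add: algebra_simps)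
    hence "y \<in> M1" "z \<in> M1" using yz half w by auto
    with yz x free show False by (auto simp: L_free_def)
  next
    fix y z assume yz: "y \<in> insert x M2" "z \<in> M2" "q * x + q * y = z"
    have z: "z = q * (x + y)" using yz by (simp add: algebra_simps)
    have "z \<le> n" using yz sub by auto
    hence sN: "x + y \<le> ?N" using z q by (simp add: less_eq_div_iff_mult_less_eq mult.commute)
    \<comment> \<open>As \<open>x > w\<close> and \<open>w\<close> is at least
      \<open>N div 2\<close>, a partner \<open>y\<close> from \<open>M2\<close> is at most
      \<open>N div 2\<close>, hence at most \<open>w\<close>.\<close>
    have "y \<in> M1" using yz(1) half sN xw w x by auto
    moreover have "z \<in> M1" using high[of "x + y"] sN xw w z yz by auto
    ultimately show False using yz x free by (auto simp: L_free_def)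
  qed
qed

lemma maximal_L_free_eqI:
  assumes q: "q \<ge> 2" and M1: "maximal_L_free q n M1" and M2: "maximal_L_free q n M2"
    and w: "e \<le> w" "n div q div 2 \<le> w"
    and low: "M1 \<inter> {1..w} = M2 \<inter> {1..w}"
    and high: "\<And>s. s \<in> {e<..n div q} \<Longrightarrow> q * s \<in> M1 \<longleftrightarrow> q * s \<in> M2"
  shows "M1 = M2"
proof -
  \<comment> \<open>Agreement up to \<open>n div q\<close> suffices: a larger \<open>x\<close> can
    be excluded only as a sum, and both summands are at most \<open>n div q\<close>.\<close>
  have aux: "A \<subseteq> B" if A: "maximal_L_free q n A" and B: "maximal_L_free q n B"
    and AB: "\<And>x. x \<le> n div q \<Longrightarrow> x \<in> A \<longleftrightarrow> x \<in> B" for A B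
  proof
    fix x assume x: "x \<in> A"
    have sub: "A \<subseteq> {1..n}" "B \<subseteq> {1..n}" and free: "L_free q A"
      using A B by (auto simp: maximal_L_free_def)
    have *: "u \<le> n div q" if "q * u + q * v \<le> n" for u v
    proof -
      have "q * u \<le> n" using that by simp
      thus ?thesis using q by (simp add: less_eq_div_iff_mult_less_eq mult.commute)
    qed
    show "x \<in> B"
    proof (rule ccontr)
      assume nx: "x \<notin> B"
      have xn: "x \<in> {1..n}" using x sub by blast
      from maximal_L_free_conflict[OF B q xn nx] show False
      proof (elim disjE bexE)
        fix y z assume yz: "y \<in> B" "z \<in> B" "x = q * y + q * z"
        hence "y \<le> n div q" "z \<le> n div q" using *[of y z] *[of z y] xn by auto
        with yz x free AB show False by (auto simp: L_free_def)
      next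
        fix y z assume yz: "y \<in> insert x B" "z \<in> B" "q * x + q * y = z"
        hence "x \<le> n div q" using *[of x y] sub by auto
        with AB x nx show False by blast
      qed
    qed
  qed
  have "x \<in> M1 \<longleftrightarrow> x \<in> M2" if "x \<le> n div q" for x
    using maximal_L_free_subsetI[OF q M1 M2 w low high _ that]
      maximal_L_free_subsetI[OF q M2 M1 w low[symmetric] high[symmetric] _ that] by blast
  with aux[OF M1 M2] aux[OF M2 M1] show ?thesis by blast
qed

section \<open>Lower bound\<close>

text \<open>Each \<open>X \<subseteq> J\<close> is the trace on \<open>J\<close> of a maximal set
  extending \<open>base X\<close>: for \<open>x\<close> in \<open>J - X\<close>, the elements 1 and
  \<open>q * (x + 1)\<close> forbid \<open>x\<close>.\<close>

lemma f_max_ge: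
  assumes q: "q \<ge> 2" and n: "n div q \<ge> 4 * q"
  shows "2 ^ (n div q - 1 - n div q div 2) \<le> f_max n q"
proof -
  define N where "N = n div q"
  \<comment> \<open>The bound \<open>x < N\<close> gives \<open>q * (x + 1) \<le> n\<close>. The
    assumption on \<open>n\<close> puts \<open>J\<close> above \<open>2 * q\<close>, the value
    obtained from 1 and 1.\<close>
  define J where "J = {N div 2 + 1..<N}"
  define base where "base X = insert 1 (X \<union> (\<lambda>x. q * (x + 1)) ` (J - X))" for X
  have qN: "q * N \<le> n" by (simp add: N_def)
  have N: "N div 2 \<ge> 2 * q" using n by (simp add: N_def)
  have mono_q: "q * u \<le> q * v" if "u \<le> v" for u v using that by simp
  have J: "N < 2 * x" "x < N" "2 * q < x" if "x \<in> J" for x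
    using that N by (auto simp: J_def)
  have up: "N < q * (x + 1)" if "x \<in> J" for x
  proof -
    have "2 * (x + 1) \<le> q * (x + 1)" using q by (rule mult_right_mono) simp
    moreover have "N < 2 * (x + 1)" using J[OF that] by simp
    ultimately show ?thesis by (rule less_le_trans[rotated])
  qed
  have base: "base X \<subseteq> {1..n} \<and> L_free q (base X)" if X: "X \<subseteq> J" for X
  proof
    have Nn: "N \<le> n" by (simp add: N_def)
    have "x \<in> {1..n}" if "x \<in> J" for x using J[OF that] Nn by auto
    moreover have "q * (x + 1) \<in> {1..n}" if "x \<in> J" for x
      using mono_q[of "x + 1" N] J[OF that] qN q by auto
    moreover have "1 \<in> {1..n}" using N q Nn by auto
    ultimately show "base X \<subseteq> {1..n}" using X unfolding base_def by blast
    have elem: "a = 1 \<or> a \<in> X \<or> N < a" if "a \<in> base X" for a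
      using that up by (auto simp: base_def)
    have big: "a = 1 \<or> N < 2 * a" if "a \<in> base X" for a
      using elem[OF that] J X by auto
    have pos: "a \<ge> 1" if "a \<in> base X" for a
      using elem[OF that] J X by (cases a) auto
    show "L_free q (base X)"
      unfolding L_free_def
    proof (intro notI, elim bexE)
      fix a b c assume abc: "a \<in> base X" "b \<in> base X" "c \<in> base X" "q * a + q * b = c"
      have c: "c = q * (a + b)" using abc(4) by (simp add: algebra_simps)
      have "2 * (a + b) \<le> q * (a + b)" using q by (rule mult_right_mono) simp
      hence c2: "2 * (a + b) \<le> c" using c by simp
      have "c \<noteq> 1" using c2 pos abc(1) by fastforce
      then consider "c \<in> X" | x where "x \<in> J - X" "c = q * (x + 1)"
        using abc(3) by (auto simp: base_def)
      thus False
      proof cases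
        case 1
        \<comment> \<open>Summands 1 and 1 give \<open>c = 2 * q\<close>; any other summand exceeds
          \<open>N / 2\<close> and forces \<open>c > N\<close>.\<close>
        hence "2 * q < c" "c < N" using J X by auto
        with c2 big[OF abc(1)] big[OF abc(2)] c q show False by auto
      next
        case 2
        have "q * (a + b) = q * (x + 1)" using 2(2) c by metis
        hence ab: "a + b = x + 1" using q by (metis mult_left_cancel not_numeral_le_zero)
        have x: "N < 2 * x" "x < N" "2 * q < x" using J 2 by auto
        \<comment> \<open>Two summands above \<open>N / 2\<close> add up to more than
          \<open>N\<close>, and 1 and 1 to less than \<open>x + 1\<close>. This leaves 1 and
          \<open>x\<close>, but \<open>x\<close> was not chosen.\<close>
        have "x \<notin> base X" using elem[of x] x 2 q by auto
        with ab big[OF abc(1)] big[OF abc(2)] abc x show False by auto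
      qed
    qed
  qed
  have "Pow J \<subseteq> (\<lambda>M. M \<inter> J) ` {M. maximal_L_free q n M}"
  proof
    fix X assume "X \<in> Pow J"
    hence X: "X \<subseteq> J" by simp
    obtain M where M: "maximal_L_free q n M" "base X \<subseteq> M"
      using exists_maximal_L_free[of "base X" n q] base[OF X] by blast
    have free: "L_free q M" using M by (simp add: maximal_L_free_def)
    have "x \<in> X" if x: "x \<in> M" "x \<in> J" for x
    proof (rule ccontr)
      assume "x \<notin> X"
      hence "q * (x + 1) \<in> M" "1 \<in> M" using x M(2) by (auto simp: base_def)
      moreover have "q * x + q * 1 = q * (x + 1)" by simp
      ultimately show False using x free unfolding L_free_def by blast
    qed
    moreover have "X \<subseteq> M" using M(2) by (auto simp: base_def)
    ultimately have "X = M \<inter> J" using X by blast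
    thus "X \<in> (\<lambda>M. M \<inter> J) ` {M. maximal_L_free q n M}" using M(1) by blast
  qed
  hence "card (Pow J) \<le> f_max n q" unfolding f_max_def
    by (rule surj_card_le[OF finite_maximal_L_free])
  moreover have "card J = N - 1 - N div 2" by (simp add: J_def)
  ultimately show ?thesis by (simp add: card_Pow N_def J_def)
qed

section \<open>Upper bound\<close>

text \<open>A union bound: the first factor bounds the number of triples \<open>(F, T, e)\<close>,
  the second the number of maximal sets belonging to one triple.\<close>

lemma f_max_le:
  assumes q: "q \<ge> 2" and h: "h > 0" and k: "k > 0" and N: "N = n div q"
  shows "real (f_max n q) \<le>
    real (N + 1) ^ (h + N div k + 1) * 2 powr ((real N + 1 + real k * real N / real h) / 2)"
proof -
  define E where "E M = {s\<in>{1..N}. q * s \<in> M}" for M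
  define W where "W F T e = sum_container N k F T \<inter> {1..max e (N div 2)}" for F T e
  define good where "good M F T e \<longleftrightarrow> maximal_L_free q n M \<and> F \<subseteq> E M \<and> e \<le> N \<and>
      (\<forall>s\<in>E M. e < s \<longrightarrow> s \<in> F) \<and> M \<inter> {1..N} \<subseteq> sum_container N k F T \<and>
      h * (2 * card (W F T e)) \<le> h * (N + 1) + k * N" for M F T e
  define Fs where "Fs = {F. F \<subseteq> {1..N} \<and> card F \<le> h}"
  define Ts where "Ts = {T. T \<subseteq> {1..N} \<and> card T \<le> N div k}"
  define I where "I = Fs \<times> Ts \<times> {0..N}"
  define S where "S = (\<lambda>(F, T, e). {M. good M F T e})"
  define B where "B = (real N + 1 + real k * real N / real h) / 2"

  have cover: "\<exists>i\<in>I. M \<in> S i" if M: "maximal_L_free q n M" for M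
  proof -
    have "finite (E M)" by (simp add: E_def)
    from exists_upper_part[OF this, of h] obtain F where F: "F \<subseteq> E M"
      "\<And>e e'. e \<in> F \<Longrightarrow> e' \<in> E M \<Longrightarrow> e < e' \<Longrightarrow> e' \<in> F" "card F \<le> h" "F = E M \<or> card F = h"
      by metis
    have FN: "F \<subseteq> {1..N}" using F(1) by (auto simp: E_def)
    have free: "L_free q M" using M by (simp add: maximal_L_free_def)
    have "x + y \<notin> F" if "x \<in> M \<inter> {1..N}" "y \<in> M \<inter> {1..N}" for x y
    proof
      assume "x + y \<in> F"
      hence "q * x + q * y \<in> M" using F(1) by (auto simp: E_def algebra_simps)
      with that free show False by (auto simp: L_free_def)
    qed
    from sum_container_covers[of "M \<inter> {1..N}" N F, OF _ this k] obtain T where T: "T \<subseteq> M \<inter> {1..N}"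
      "card T * k \<le> N" "M \<inter> {1..N} \<subseteq> sum_container N k F T" by auto
    have TN: "T \<subseteq> {1..N}" "card T \<le> N div k"
      using T k by (auto simp: less_eq_div_iff_mult_less_eq)
    have "\<exists>e. good M F T e"
    proof (cases "F = E M")
      case True
      have "card (W F T 0) \<le> card {1..N div 2}" unfolding W_def by (rule card_mono) auto
      hence "2 * card (W F T 0) \<le> N + 1" by simp
      hence "h * (2 * card (W F T 0)) \<le> h * (N + 1)" by (rule mult_le_mono2)
      with True M T show ?thesis unfolding good_def by (intro exI[of _ 0]) auto
    next
      case False
      hence cF: "card F = h" using F by blast
      have fin: "finite F" "F \<noteq> {}" using cF h by (auto intro: card_ge_0_finite)
      obtain e where e: "e \<in> F"
        "card F * card {x\<in>sum_container N k F T. x < e \<and> e - x \<in> sum_container N k F T} \<le> k * N"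
        using sum_container_few_sums[OF fin refl] by blast
      let ?r = "card {x\<in>sum_container N k F T. x < e \<and> e - x \<in> sum_container N k F T}"
      have eN: "1 \<le> e" "e \<le> N" using e(1) FN by auto
      have "2 * card (W F T e) \<le> N + 1 + ?r"
        unfolding W_def by (rule card_reflection_le[OF sum_container_subset eN])
      hence "h * (2 * card (W F T e)) \<le> h * (N + 1 + ?r)" by (rule mult_le_mono2)
      also have "\<dots> \<le> h * (N + 1) + k * N" using e(2) cF by (simp add: algebra_simps)
      finally show ?thesis unfolding good_def using M F e eN T by blast
    qed
    then obtain e where e: "good M F T e" by blast
    hence "e \<le> N" by (simp add: good_def)
    with FN F TN have "(F, T, e) \<in> I" by (auto simp: I_def Fs_def Ts_def)
    moreover have "M \<in> S (F, T, e)" using e by (simp add: S_def)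
    ultimately show ?thesis by blast
  qed

  have cardS: "real (card (S i)) \<le> 2 powr B" for i
  proof -
    obtain F T e where i: "i = (F, T, e)" by (cases i) auto
    show ?thesis
    \<comment> \<open>The bound on \<open>card (W F T e)\<close> is part of \<open>good\<close>, so
      it is available only from a member of \<open>S i\<close>.\<close>
    proof (cases "S i = {}")
      case True
      thus ?thesis by simp
    next
      case False
      then obtain M0 where M0: "good M0 F T e" using i by (auto simp: S_def)
      have finW: "finite (W F T e)" by (simp add: W_def)
      \<comment> \<open>The container makes the trace on \<open>W\<close> the whole trace up to
        \<open>max e (N div 2)\<close>, and \<open>F\<close> decides which \<open>q * s\<close> with
        \<open>s > e\<close> belong to the set.\<close>
      have inj: "inj_on (\<lambda>M. M \<inter> W F T e) (S i)"
      proof (rule inj_onI)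
        fix M1 M2 assume "M1 \<in> S i" "M2 \<in> S i" and eq: "M1 \<inter> W F T e = M2 \<inter> W F T e"
        hence M: "good M1 F T e" "good M2 F T e" using i by (auto simp: S_def)
        have trace: "M' \<inter> {1..max e (N div 2)} = M' \<inter> W F T e" if "good M' F T e" for M'
        proof -
          have "M' \<inter> {1..N} \<subseteq> sum_container N k F T" "e \<le> N"
            using that by (simp_all add: good_def)
          moreover from this have "{1..max e (N div 2)} \<subseteq> {1..N}" by simp
          ultimately show ?thesis unfolding W_def by blast
        qed
        have top: "q * s \<in> M' \<longleftrightarrow> s \<in> F" if "good M' F T e" "s \<in> {e<..n div q}" for s M'
        proof -
          have "s \<in> {1..N}" using that N by auto
          hence "q * s \<in> M' \<longleftrightarrow> s \<in> E M'" by (simp add: E_def)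
          thus ?thesis using that by (auto simp: good_def)
        qed
        show "M1 = M2"
        proof (rule maximal_L_free_eqI[OF q])
          show "maximal_L_free q n M1" "maximal_L_free q n M2" using M by (auto simp: good_def)
          show "e \<le> max e (N div 2)" "n div q div 2 \<le> max e (N div 2)" by (auto simp: N)
          show "M1 \<inter> {1..max e (N div 2)} = M2 \<inter> {1..max e (N div 2)}"
            using trace M eq by metis
          show "q * s \<in> M1 \<longleftrightarrow> q * s \<in> M2" if "s \<in> {e<..n div q}" for s
            using top[OF M(1) that] top[OF M(2) that] by metis
        qed
      qed
      have "card (S i) \<le> card (Pow (W F T e))"
        by (rule card_inj_on_le[OF inj]) (use finW in auto)
      hence "real (card (S i)) \<le> real (2 ^ card (W F T e))"
        using finW by (simp only: of_nat_le_iff card_Pow)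
      also have "\<dots> = 2 powr real (card (W F T e))" by (simp add: powr_realpow)
      also have "\<dots> \<le> 2 powr B"
      proof (rule powr_mono)
        have "h * (2 * card (W F T e)) \<le> h * (N + 1) + k * N" using M0 by (simp add: good_def)
        hence "real (h * (2 * card (W F T e))) \<le> real (h * (N + 1) + k * N)"
          by (simp only: of_nat_le_iff)
        thus "real (card (W F T e)) \<le> B" using h by (simp add: B_def field_simps)
      qed simp
      finally show ?thesis .
    qed
  qed

  have finI: "finite I" by (simp add: I_def Fs_def Ts_def)
  have finS: "finite (S i)" for i
    by (rule finite_subset[OF _ finite_maximal_L_free[of q n]]) (auto simp: S_def good_def split: prod.splits)
  have "f_max n q \<le> card (\<Union>i\<in>I. S i)"
    unfolding f_max_def by (rule card_mono) (use finI finS cover in auto)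
  also have "\<dots> \<le> (\<Sum>i\<in>I. card (S i))" by (rule card_UN_le[OF finI])
  finally have "real (f_max n q) \<le> (\<Sum>i\<in>I. real (card (S i)))"
    by (metis of_nat_le_iff of_nat_sum)
  also have "\<dots> \<le> real (card I) * 2 powr B"
    by (rule sum_bounded_above) (rule cardS)
  also have "card I \<le> (N + 1) ^ (h + N div k + 1)"
  proof -
    have "card I = card Fs * (card Ts * (N + 1))" by (simp add: I_def card_cartesian_product)
    also have "\<dots> \<le> (N + 1) ^ h * ((N + 1) ^ (N div k) * (N + 1))"
      unfolding Fs_def Ts_def by (intro mult_le_mono card_small_subsets_le order_refl)
    finally show ?thesis by (simp only: power_add power_one_right mult.assoc)
  qed
  hence "real (card I) * 2 powr B \<le> real ((N + 1) ^ (h + N div k + 1)) * 2 powr B"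
    by (intro mult_right_mono of_nat_mono) auto
  finally show ?thesis by (simp only: B_def of_nat_power)
qed

section \<open>Logarithmic estimates and the limit\<close>

lemma f_max_pos: "f_max n q > 0"
proof -
  have "L_free q {}" by (simp add: L_free_def)
  then obtain M where "maximal_L_free q n M" using exists_maximal_L_free[of "{}" n q] by auto
  thus ?thesis unfolding f_max_def using finite_maximal_L_free[of q n] by (auto simp: card_gt_0_iff)
qed

lemma log_f_max_le:
  assumes q: "q \<ge> 2" and n: "n > 0"
  shows "log 2 (f_max n q) - real n / (2 * real q) \<le>
    (2 * real n powr (3/4) + 2) * log 2 (real n + 1) + (1 + real n powr (1/2) + real n powr (1/4)) / 2"
proof -
  \<comment> \<open>These exponents balance \<open>h\<close> against \<open>N div k\<close>, both of
    order at most \<open>n powr (3/4)\<close>, and keep \<open>k * N / h\<close> of order at most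
    \<open>n powr (1/2)\<close>. The final \<open>+ 2\<close> in the factor of the logarithm pays
    for rounding \<open>h\<close> up and for the choice of \<open>e\<close>.\<close>
  define h where "h = nat \<lceil>real n powr (3/4)\<rceil>"
  define k where "k = nat \<lceil>real n powr (1/4)\<rceil>"
  define N where "N = n div q"
  have pos: "real n powr (3/4) > 0" "real n powr (1/4) > 0" using n by auto
  have h: "real n powr (3/4) \<le> real h" "real h \<le> real n powr (3/4) + 1"
    and k: "real n powr (1/4) \<le> real k" "real k \<le> real n powr (1/4) + 1"
    using pos unfolding h_def k_def by linarith+
  have hk: "h > 0" "k > 0" using h k pos by (auto intro: gr0I)
  have Nn: "N \<le> n" by (simp add: N_def)
  have "real N \<le> real n / real q" unfolding N_def by (rule of_nat_div_le_of_nat)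
  hence Nq: "real N / 2 \<le> real n / (2 * real q)" by (simp add: field_simps)
  have "real (N div k) \<le> real N / real k" by (rule of_nat_div_le_of_nat)
  also have "\<dots> \<le> real n / real n powr (1/4)"
    by (rule frac_le) (use Nn k pos in auto)
  also have "\<dots> = real n powr (1 - 1/4)" using n by (subst powr_diff) auto
  finally have Nk: "real (N div k) \<le> real n powr (3/4)" by simp
  have "real k * real N / real h \<le> (real n powr (1/4) + 1) * real n / real n powr (3/4)"
    by (intro frac_le mult_mono) (use Nn k h pos in auto)
  also have "\<dots> = real n powr (1/4) * real n powr (1 - 3/4) + real n powr (1 - 3/4)"
    using n by (subst (1 2) powr_diff) (auto simp: field_simps)
  also have "\<dots> = real n powr (1/2) + real n powr (1/4)"
    by (subst powr_add[symmetric]) simp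
  finally have kNh: "real k * real N / real h \<le> real n powr (1/2) + real n powr (1/4)" .
  have log_prod: "log 2 (x ^ m * 2 powr b) = real m * log 2 x + b" if "x > 0" for x b and m :: nat
    using that by (simp add: log_mult log_nat_power)
  have "log 2 (f_max n q) \<le> log 2 (real (N + 1) ^ (h + N div k + 1) *
      2 powr ((real N + 1 + real k * real N / real h) / 2))"
    using f_max_pos[of n q] f_max_le[OF q hk N_def] by simp
  also have "\<dots> = real (h + N div k + 1) * log 2 (real (N + 1)) +
      (real N + 1 + real k * real N / real h) / 2"
    by (rule log_prod) simp
  also have "real (h + N div k + 1) * log 2 (real (N + 1)) \<le>
      (2 * real n powr (3/4) + 2) * log 2 (real n + 1)"
    by (intro mult_mono) (use h Nk Nn in auto)
  finally show ?thesis using Nq kNh by (simp add: field_simps)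
qed

text \<open>The exponent from \<open>f_max_ge\<close> is at least \<open>N / 2 - 1\<close>, and
  replacing \<open>n / q\<close> by its floor \<open>N\<close> costs at most another
  \<open>1 / 2\<close>.\<close>

lemma log_f_max_ge:
  assumes q: "q \<ge> 2" and n: "n \<ge> 4 * q * q"
  shows "real n / (2 * real q) - 2 \<le> log 2 (f_max n q)"
proof -
  define N where "N = n div q"
  have N: "4 * q \<le> N" using n q by (simp add: N_def less_eq_div_iff_mult_less_eq)
  have "n \<le> q * (N + 1)"
    using q dividend_less_times_div[of q n] by (simp add: N_def)
  hence "real n \<le> real q * (real N + 1)" by (metis of_nat_1 of_nat_add of_nat_le_iff of_nat_mult)
  hence "real n / real q \<le> real N + 1" using q by (simp add: field_simps)
  hence "real n / (2 * real q) \<le> (real N + 1) / 2" by (simp add: field_simps)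
  moreover have "real N \<le> real (2 * (N - 1 - N div 2) + 2)"
    unfolding of_nat_le_iff using N q by linarith
  moreover have "t - 2 \<le> real j" if "t \<le> (real N + 1) / 2" "real N \<le> real (2 * j + 2)" for t j
    using that by simp
  ultimately have "real n / (2 * real q) - 2 \<le> real (N - 1 - N div 2)" by blast
  also have "\<dots> \<le> log 2 (f_max n q)"
  proof (rule le_log_of_power)
    have "2 ^ (N - 1 - N div 2) \<le> f_max n q" using f_max_ge[OF q] N by (simp add: N_def)
    thus "(2::real) ^ (N - 1 - N div 2) \<le> real (f_max n q)"
      by (metis of_nat_le_iff of_nat_numeral of_nat_power)
  qed simp
  finally show ?thesis .
qed

theorem theorem1p3:
  fixes q :: nat
  assumes "q \<ge> 2"
  shows "\<exists>e :: nat \<Rightarrow> real. e \<in> o(\<lambda>n. real n) \<and>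
           (\<forall>n. real (f_max n q) = 2 powr (real n / (2 * real q) + e n))"
proof (intro exI conjI allI)
  define e where "e n = log 2 (f_max n q) - real n / (2 * real q)" for n
  \<comment> \<open>The upper estimate plus 2, so that \<open>g\<close> also dominates the deviation
    of at most 2 below zero.\<close>
  define g where "g n = (2 * real n powr (3/4) + 2) * log 2 (real n + 1) +
    (1 + real n powr (1/2) + real n powr (1/4)) / 2 + 2" for n
  show "real (f_max n q) = 2 powr (real n / (2 * real q) + e n)" for n
    using f_max_pos[of n q] by (simp add: e_def)
  have "eventually (\<lambda>n. norm (e n) \<le> norm (g n)) at_top"
    using eventually_ge_at_top[of "4 * q * q"]
  proof eventually_elim
    case (elim n)
    have "0 < 4 * q * q" using assms by simp
    hence "n > 0" using elim by linarith
    have "0 \<le> g n - 2" unfolding g_def by simp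
    moreover have "e n \<le> g n - 2" using log_f_max_le[OF assms \<open>n > 0\<close>] by (simp add: e_def g_def)
    moreover have "-2 \<le> e n" using log_f_max_ge[OF assms elim] by (simp add: e_def)
    ultimately show ?case by simp
  qed
  hence "e \<in> O(g)" by (intro landau_o.big_mono)
  also have "g \<in> o(\<lambda>n. real n)" unfolding g_def by real_asymp
  finally show "e \<in> o(\<lambda>n. real n)" .
qed

end
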